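(* For every integer $n\ge 1$, the matrix ring over dual numbers $M_n(\mathbb{D})$ is strongly clean.
   Context: $\mathbb{D}=\{a+b\epsilon \mid a,b\in\mathbb{R},\ \epsilon^2=0\}$ is the ring of dual numbers, and $M_n(\mathbb{D})$ is the ring of $n\times n$ matrices over $\mathbb{D}$. An element $a$ of a ring $R$ (associative with identity) is strongly clean if $a=e+u$ with $e^2=e\in R$, $u$ a unit of $R$, and $eu=ue$. A ring is strongly clean if every element of it is strongly clean. *)

theory Defs
  imports Complex_Main "Jordan_Normal_Form.Matrix"
begin

datatype dual = Dual (std_part: real) (eps_part: real)

instantiation dual :: comm_ring_1
begin

definition zero_dual :: dual where
  "0 = Dual 0 0"

definition one_dual :: dual where
  "1 = Dual 1 0"

definition plus_dual :: "dual \<Rightarrow> dual \<Rightarrow> dual" where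
  "x + y = Dual (std_part x + std_part y) (eps_part x + eps_part y)"

definition minus_dual :: "dual \<Rightarrow> dual \<Rightarrow> dual" where
  "x - y = Dual (std_part x - std_part y) (eps_part x - eps_part y)"

definition uminus_dual :: "dual \<Rightarrow> dual" where
  "- x = Dual (- std_part x) (- eps_part x)"

definition times_dual :: "dual \<Rightarrow> dual \<Rightarrow> dual" where
  "x * y = Dual (std_part x * std_part y)
                (std_part x * eps_part y + eps_part x * std_part y)"

instance
  by standard
    (auto simp: zero_dual_def one_dual_def plus_dual_def minus_dual_def
      uminus_dual_def times_dual_def algebra_simps)

end

definition dual_of_real :: "real \<Rightarrow> dual" where
  "dual_of_real a = Dual a 0"

definition eps :: dual where
  "eps = Dual 0 1"

lemma eps_squared: "eps ^ 2 = 0"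
  by (simp add: eps_def power2_eq_square times_dual_def zero_dual_def)

lemma Dual_eq: "Dual a b = dual_of_real a + dual_of_real b * eps"
  by (simp add: dual_of_real_def eps_def plus_dual_def times_dual_def)

definition strongly_clean_element :: "('a, 'b) ring_scheme \<Rightarrow> 'a \<Rightarrow> bool" where
  "strongly_clean_element R a \<longleftrightarrow>
    (\<exists>e \<in> carrier R. \<exists>u \<in> Units R.
       e \<otimes>\<^bsub>R\<^esub> e = e \<and> e \<otimes>\<^bsub>R\<^esub> u = u \<otimes>\<^bsub>R\<^esub> e \<and> a = e \<oplus>\<^bsub>R\<^esub> u)"

definition strongly_clean_ring :: "('a, 'b) ring_scheme \<Rightarrow> bool" where
  "strongly_clean_ring R \<longleftrightarrow>
    ring R \<and> (\<forall>a \<in> carrier R. strongly_clean_element R a)"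

end

(* The ring M_n(D) is a finite-dimensional real algebra, so every matrix A is annihilated by
   some nonzero real polynomial p.  Factor p = x^k q with q(0) \<noteq> 0 and choose
   s x^k + t q = 1.  Modulo p, the polynomial t q is idempotent, and x - t q is coprime to p:
   it is congruent to x modulo q and to -1 modulo x.  Evaluating at A gives the decomposition. *)
theory Submission
  imports
    Defs
    "HOL-Computational_Algebra.Polynomial_Factorial"
    "HOL-Computational_Algebra.Field_as_Ring"
begin

text \<open>Induction on \<open>S\<close>: a new functional is killed by combining two solutions for
  the old ones. The bound \<open>m\<close> is arbitrary so that the second solution can be given
  larger degree than the first.\<close>

lemma common_zero_of_functionals:
  fixes F :: "'s \<Rightarrow> 'k::field poly \<Rightarrow> 'k"
  assumes "finite S"
    and add: "\<And>s p q. s \<in> S \<Longrightarrow> F s (p + q) = F s p + F s q"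
    and smult: "\<And>s c p. s \<in> S \<Longrightarrow> F s (smult c p) = c * F s p"
  shows "\<exists>p. m < degree p \<and> (\<forall>s\<in>S. F s p = 0)"
  using assms
proof (induction S arbitrary: m rule: finite_induct)
  case empty
  have "m < degree (monom (1::'k) (Suc m))"
    by (simp add: degree_monom_eq)
  then show ?case by blast
next
  case (insert t S)
  have IH: "\<exists>p. m < degree p \<and> (\<forall>s\<in>S. F s p = 0)" for m
    using insert.IH insert.prems by blast
  obtain p where p: "m < degree p" "\<forall>s\<in>S. F s p = 0"
    using IH by blast
  obtain p' where p': "degree p < degree p'" "\<forall>s\<in>S. F s p' = 0"
    using IH by blast
  show ?case
  proof (cases "F t p = 0")
    case True
    with p show ?thesis by auto
  next
    case False
    \<comment> \<open>The scalar cancels \<open>F t\<close>, and the leading term of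
      \<open>p'\<close> survives because \<open>degree p < degree p'\<close>.\<close>
    define r where "r = p' + smult (- (F t p' / F t p)) p"
    have "degree r = degree p'"
      unfolding r_def by (rule degree_add_eq_left) (use p' degree_smult_le le_less_trans in blast)
    moreover have "F s r = 0" if "s \<in> insert t S" for s
      using that False p p' by (auto simp: r_def insert.prems simp del: smult_minus_left)
    ultimately show ?thesis
      using p p' by (intro exI[of _ r]) auto
  qed
qed

text \<open>Idempotence of \<open>f\<close> and invertibility of \<open>[:0, 1:] - f\<close> modulo
  \<open>p\<close> are phrased as a divisibility and a Bezout identity, since evaluation where
  \<open>p\<close> vanishes turns these directly into ring equations.\<close>

lemma poly_coprime_decomposition:
  fixes p :: "'k::field_gcd poly"
  assumes "p \<noteq> 0"
  obtains f v w where "p dvd f * f - f" "([:0, 1:] - f) * v + w * p = 1"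
proof -
  define X where "X = [:0, 1::'k:]"
  \<comment> \<open>\<open>k\<close> is the multiplicity of 0 as a root of \<open>p\<close>,
    possibly 0.\<close>
  obtain k q where pq: "p = X ^ k * q" and q: "\<not> X dvd q"
    using order_decomp[OF assms, of 0] by (auto simp: X_def)
  have prime: "prime_elem X"
    unfolding X_def by (rule prime_elem_linear_poly) auto
  have Xq: "coprime X q"
    using prime q by (rule prime_elem_imp_coprime)
  then have "coprime (X ^ k) q"
    by simp
  then obtain s t where st: "s * X ^ k + t * q = 1"
    using bezout_coefficients_fst_snd[of "X ^ k" q] by (metis coprime_imp_gcd_eq_1)
  define f where "f = t * q"
  have "f * f - f = p * (- (s * t))"
  proof -
    have "f - 1 = - (s * X ^ k)"
      using st by (simp add: f_def algebra_simps)
    then have "f * (f - 1) = f * (- (s * X ^ k))"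
      by simp
    then show ?thesis
      by (simp add: f_def pq algebra_simps)
  qed
  then have "p dvd f * f - f"
    by simp
  moreover have "coprime (X - f) p"
  proof -
    \<comment> \<open>\<open>f = t * q\<close> vanishes modulo \<open>q\<close>.\<close>
    have "gcd q (X - f) = gcd q X"
      using gcd_add_mult[of q "- t" X] by (simp add: f_def)
    then have "coprime (X - f) q"
      using Xq by (metis coprime_iff_gcd_eq_1 gcd.commute)
    moreover have "coprime (X - f) (X ^ k)"
    proof (cases "k = 0")
      case False
      \<comment> \<open>Only for positive \<open>k\<close> does \<open>f = 1 - s * X ^ k\<close>
        give \<open>f\<close> the residue 1 modulo \<open>X\<close>; for \<open>k = 0\<close> the
        power is 1 and coprimality is trivial.\<close>
      have "\<not> X dvd X - f"
      proof
        assume "X dvd X - f"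
        then have "X dvd f"
          using dvd_diff[of X X "X - f"] by simp
        moreover have "X dvd s * X ^ k"
          using False by simp
        ultimately have "X dvd 1"
          using st dvd_add f_def by metis
        then show False
          using prime by (simp add: prime_elem_def)
      qed
      then have "coprime X (X - f)"
        using prime prime_elem_imp_coprime by blast
      then show ?thesis
        by (simp add: coprime_commute)
    qed simp
    ultimately show ?thesis
      by (simp add: pq)
  qed
  then obtain v w where "v * (X - f) + w * p = 1"
    using bezout_coefficients_fst_snd[of "X - f" p] by (metis coprime_imp_gcd_eq_1)
  ultimately show ?thesis
    using that[of f v w] by (simp add: X_def mult.commute)
qed

text \<open>\<open>R\<close> may be noncommutative: for evaluation at \<open>a\<close> to be
  multiplicative, the scalars \<open>h c\<close> have to commute with \<open>a\<close>
  alone.\<close>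

locale poly_evaluation = ring R for R (structure) +
  fixes h :: "'k::field \<Rightarrow> 'a" and a :: 'a
  assumes h_closed [simp, intro]: "h c \<in> carrier R"
    and a_closed [simp, intro]: "a \<in> carrier R"
    and h_add: "h (c + d) = h c \<oplus> h d"
    and h_mult: "h (c * d) = h c \<otimes> h d"
    and h_one: "h 1 = \<one>"
    and h_commute: "h c \<otimes> a = a \<otimes> h c"
begin

lemma h_zero: "h 0 = \<zero>"
  using h_add[of 0 0] by (simp add: add.r_cancel_one')

text \<open>Horner's scheme; \<open>coeffs\<close> lists the constant term first.\<close>

definition eval_poly :: "'k poly \<Rightarrow> 'a" where
  "eval_poly p = foldr (\<lambda>c y. h c \<oplus> a \<otimes> y) (coeffs p) \<zero>"

lemma eval_poly_0 [simp]: "eval_poly 0 = \<zero>"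
  by (simp add: eval_poly_def)

lemma eval_poly_pCons: "eval_poly (pCons c p) = h c \<oplus> a \<otimes> eval_poly p"
  \<comment> \<open>\<open>cCons\<close> drops \<open>c\<close> when \<open>c = 0\<close> and
    \<open>p = 0\<close>; \<open>h_zero\<close> settles that case.\<close>
  by (auto simp: eval_poly_def cCons_def h_zero)

lemma eval_poly_closed [simp, intro]: "eval_poly p \<in> carrier R"
  by (induction p) (auto simp: eval_poly_pCons)

lemma eval_poly_one: "eval_poly 1 = \<one>"
  by (simp add: one_pCons eval_poly_pCons h_one)

lemma eval_poly_X: "eval_poly [:0, 1:] = a"
  by (simp add: eval_poly_pCons h_one h_zero)

lemma eval_poly_add: "eval_poly (p + q) = eval_poly p \<oplus> eval_poly q"
  by (induction p q rule: poly_induct2) (auto simp: eval_poly_pCons h_add r_distr a_ac)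

lemma eval_poly_smult: "eval_poly (smult c p) = h c \<otimes> eval_poly p"
proof (induction p)
  case (pCons d p)
  \<comment> \<open>The scalar moves past \<open>a\<close> by \<open>h_commute\<close>.\<close>
  have "a \<otimes> (h c \<otimes> eval_poly p) = h c \<otimes> (a \<otimes> eval_poly p)"
    by (simp add: h_commute flip: m_assoc)
  then show ?case
    by (simp add: eval_poly_pCons pCons.IH h_mult r_distr)
qed simp

lemma eval_poly_mult: "eval_poly (p * q) = eval_poly p \<otimes> eval_poly q"
  by (induction p)
    (auto simp: eval_poly_pCons eval_poly_add eval_poly_smult h_zero l_distr m_assoc)

end

text \<open>Finitely many linear functionals that separate points stand in for finite dimension.
  Composed with evaluation they act on polynomials, where they have a common zero of positive
  degree.\<close>

lemma (in poly_evaluation) annihilating_poly_exists: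
  fixes L :: "'s \<Rightarrow> 'a \<Rightarrow> 'k"
  assumes "finite S"
    and add: "\<And>s x y. s \<in> S \<Longrightarrow> x \<in> carrier R \<Longrightarrow> y \<in> carrier R \<Longrightarrow> L s (x \<oplus> y) = L s x + L s y"
    and scale: "\<And>s c x. s \<in> S \<Longrightarrow> x \<in> carrier R \<Longrightarrow> L s (h c \<otimes> x) = c * L s x"
    and inj: "\<And>x. x \<in> carrier R \<Longrightarrow> (\<And>s. s \<in> S \<Longrightarrow> L s x = 0) \<Longrightarrow> x = \<zero>"
  obtains p where "p \<noteq> 0" "eval_poly p = \<zero>"
proof -
  obtain p where "0 < degree p" "\<forall>s\<in>S. L s (eval_poly p) = 0"
    using common_zero_of_functionals[of S "\<lambda>s p. L s (eval_poly p)" 0] assms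
    by (auto simp: eval_poly_add eval_poly_smult)
  then show ?thesis
    using that[of p] inj[of "eval_poly p"] by fastforce
qed

text \<open>Evaluation at \<open>a\<close> is a ring homomorphism killing \<open>p\<close>, so the
  images of \<open>f\<close> and \<open>[:0, 1:] - f\<close> are the required idempotent and
  unit.\<close>

lemma strongly_clean_element_algebraic:
  fixes h :: "'k::field_gcd \<Rightarrow> 'a"
  assumes "poly_evaluation R h a"
    and "p \<noteq> 0" "poly_evaluation.eval_poly R h a p = \<zero>\<^bsub>R\<^esub>"
  shows "strongly_clean_element R a"
proof -
  interpret poly_evaluation R h a by fact
  have p0: "eval_poly p = \<zero>\<^bsub>R\<^esub>" by fact
  obtain f v w where f: "p dvd f * f - f" and v: "([:0, 1:] - f) * v + w * p = 1"
    using poly_coprime_decomposition[OF \<open>p \<noteq> 0\<close>] by blast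
  obtain g where "f * f - f = p * g"
    using f by (elim dvdE)
  \<comment> \<open>Rewritten without subtraction, so that additivity and multiplicativity of
    evaluation apply.\<close>
  then have "f * f = f + p * g"
    by (simp add: algebra_simps)
  from arg_cong[OF this, of eval_poly]
  have idem: "eval_poly f \<otimes>\<^bsub>R\<^esub> eval_poly f = eval_poly f"
    by (simp add: eval_poly_mult eval_poly_add p0)
  define u where "u = [:0, 1:] - f"
  \<comment> \<open>Commutativity of the polynomial ring passes to the images. It makes the
    one-sided inverse below two-sided and lets idempotent and unit commute.\<close>
  have comm: "eval_poly p \<otimes>\<^bsub>R\<^esub> eval_poly q = eval_poly q \<otimes>\<^bsub>R\<^esub> eval_poly p" for p q
    by (metis eval_poly_mult mult.commute)
  have inv: "eval_poly u \<otimes>\<^bsub>R\<^esub> eval_poly v = \<one>\<^bsub>R\<^esub>"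
    using arg_cong[OF v, of eval_poly]
    by (simp add: u_def eval_poly_mult eval_poly_add eval_poly_one p0)
  then have unit: "eval_poly u \<in> Units R"
    using comm[of u v] by (auto simp: Units_def)
  have "eval_poly f \<oplus>\<^bsub>R\<^esub> eval_poly u = a"
    by (simp add: u_def eval_poly_X flip: eval_poly_add)
  with idem unit comm show ?thesis
    unfolding strongly_clean_element_def by (metis eval_poly_closed)
qed

text \<open>Coefficients are real because the polynomial argument needs a field, which
  \<open>dual\<close> is not. They act as scalar matrices, which are central.\<close>

lemma dual_scalar_evaluation:
  assumes A: "A \<in> carrier_mat n n"
  shows "poly_evaluation (ring_mat TYPE(dual) n ()) (\<lambda>c. dual_of_real c \<cdot>\<^sub>m 1\<^sub>m n) A"
proof -
  interpret ring "ring_mat TYPE(dual) n ()"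
    by (rule ring_mat)
  show ?thesis
  proof
    fix c d :: real
    show "dual_of_real (c + d) \<cdot>\<^sub>m 1\<^sub>m n =
        dual_of_real c \<cdot>\<^sub>m 1\<^sub>m n \<oplus>\<^bsub>ring_mat TYPE(dual) n ()\<^esub> dual_of_real d \<cdot>\<^sub>m 1\<^sub>m n"
      by (auto simp: ring_mat_simps dual_of_real_def plus_dual_def zero_dual_def one_dual_def
          times_dual_def)
    have "dual_of_real (c * d) = dual_of_real c * dual_of_real d"
      by (simp add: dual_of_real_def times_dual_def)
    then show "dual_of_real (c * d) \<cdot>\<^sub>m 1\<^sub>m n =
        dual_of_real c \<cdot>\<^sub>m 1\<^sub>m n \<otimes>\<^bsub>ring_mat TYPE(dual) n ()\<^esub> (dual_of_real d \<cdot>\<^sub>m 1\<^sub>m n)"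
      by (auto simp: ring_mat_simps mult_smult_assoc_mat[of _ n n _ n])
    have "dual_of_real 1 = 1"
      by (simp add: dual_of_real_def one_dual_def)
    then show "dual_of_real 1 \<cdot>\<^sub>m 1\<^sub>m n = \<one>\<^bsub>ring_mat TYPE(dual) n ()\<^esub>"
      by (auto simp: ring_mat_simps)
    show "dual_of_real c \<cdot>\<^sub>m 1\<^sub>m n \<otimes>\<^bsub>ring_mat TYPE(dual) n ()\<^esub> A =
        A \<otimes>\<^bsub>ring_mat TYPE(dual) n ()\<^esub> (dual_of_real c \<cdot>\<^sub>m 1\<^sub>m n)"
      using A by (simp add: ring_mat_simps mult_smult_assoc_mat[of _ n n _ n]
          mult_smult_distrib[of _ n n _ n])
  qed (use A in \<open>auto simp: ring_mat_simps\<close>)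
qed

lemma strongly_clean_element_dual_mat:
  assumes A: "A \<in> carrier_mat n n"
  shows "strongly_clean_element (ring_mat TYPE(dual) n ()) A"
proof -
  interpret poly_evaluation "ring_mat TYPE(dual) n ()" "\<lambda>c. dual_of_real c \<cdot>\<^sub>m 1\<^sub>m n" A
    using A by (rule dual_scalar_evaluation)
  \<comment> \<open>Indices of the \<open>2 * n * n\<close> real coordinates of a matrix; the first
    component is itself the function reading off a part.\<close>
  define S where "S = {std_part, eps_part} \<times> {..<n} \<times> {..<n}"
  define L :: "(dual \<Rightarrow> real) \<times> nat \<times> nat \<Rightarrow> dual mat \<Rightarrow> real"
    where "L = (\<lambda>(part, ij) X. part (X $$ ij))"
  obtain p where "p \<noteq> 0" "eval_poly p = \<zero>\<^bsub>ring_mat TYPE(dual) n ()\<^esub>"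
  proof (rule annihilating_poly_exists[of S L])
    show "finite S"
      by (simp add: S_def)
  next
    fix s and X Y :: "dual mat"
    assume "s \<in> S" "X \<in> carrier (ring_mat TYPE(dual) n ())" "Y \<in> carrier (ring_mat TYPE(dual) n ())"
    then show "L s (X \<oplus>\<^bsub>ring_mat TYPE(dual) n ()\<^esub> Y) = L s X + L s Y"
      by (auto simp: S_def L_def ring_mat_simps plus_dual_def)
  next
    fix s c and X :: "dual mat"
    assume s: "s \<in> S" and X: "X \<in> carrier (ring_mat TYPE(dual) n ())"
    then have "dual_of_real c \<cdot>\<^sub>m 1\<^sub>m n \<otimes>\<^bsub>ring_mat TYPE(dual) n ()\<^esub> X = dual_of_real c \<cdot>\<^sub>m X"
      by (simp add: ring_mat_simps mult_smult_assoc_mat[of _ n n _ n])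
    \<comment> \<open>A real scalar has \<open>eps_part\<close> 0, so the product has no cross term
      and both parts scale by \<open>c\<close>.\<close>
    with s X show "L s (dual_of_real c \<cdot>\<^sub>m 1\<^sub>m n \<otimes>\<^bsub>ring_mat TYPE(dual) n ()\<^esub> X) = c * L s X"
      by (auto simp: S_def L_def ring_mat_simps times_dual_def dual_of_real_def)
  next
    fix X :: "dual mat"
    assume "X \<in> carrier (ring_mat TYPE(dual) n ())" and 0: "\<And>s. s \<in> S \<Longrightarrow> L s X = 0"
    moreover have "X $$ (i, j) = 0" if "i < n" "j < n" for i j
      using that 0[of "(std_part, i, j)"] 0[of "(eps_part, i, j)"]
      by (auto simp: S_def L_def zero_dual_def dual.expand)
    ultimately show "X = \<zero>\<^bsub>ring_mat TYPE(dual) n ()\<^esub>"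
      by (auto simp: ring_mat_simps)
  qed
  then show ?thesis
    by (rule strongly_clean_element_algebraic[OF poly_evaluation_axioms])
qed

theorem theorem4p2:
  fixes n :: nat
  assumes "n \<ge> 1"
  shows "strongly_clean_ring (ring_mat TYPE(dual) n ())"
  unfolding strongly_clean_ring_def
  using strongly_clean_element_dual_mat by (auto simp: ring_mat ring_mat_simps)

end
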